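(* Let $(P,\preceq,\wedge,\vee,\hat 0)$ be a locally finite lattice with least element $\hat 0$, let $f:P\to\mathbb{C}$ be semimultiplicative with $f(x)\neq 0$ for all $x\in P$, and put $g(x)=1/f(x)$. Let $S=\{x_1,\ldots,x_n\}$ be a finite meet closed subset of $P$ such that $x_i\preceq x_j$ only if $i\leq j$, and suppose $\Delta_i(g)\neq 0$ for all $i$. Then every $\lambda\in\mathbb{C}$ for which there is $x\in\mathbb{C}^n\setminus\{0\}$ with $(S)_fx=\lambda[S]_fx$ satisfies \[ |\lambda|\leq\frac{M_f\,m_g^{-1}\,C_n\,c_n^{-1}}{\min_{1\leq i\leq n}|f(x_i)|^2},\qquad M_f=\max_{1\le i\le n}|\Delta_i(f)|,\ m_g=\min_{1\le i\le n}|\Delta_i(g)|. \] If in addition $\Delta_i(f)\neq 0$ for all $i$, then every such $\lambda$ satisfies \[ |\lambda|\geq\frac{m_f\,M_g^{-1}\,C_n^{-1}\,c_n}{\max_{1\leq i\leq n}|f(x_i)|^2},\qquad m_f=\min_{1\le i\le n}|\Delta_i(f)|,\ M_g=\max_{1\le i\le n}|\Delta_i(g)|. \]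
   Context: Incidence functions of a poset $P$ are functions $h:P\times P\to\mathbb{C}$ with $h(x,y)=0$ whenever $x\not\preceq y$; convolution $(h*k)(x,y)=\sum_{x\preceq z\preceq y}h(x,z)k(z,y)$. The Möbius function $\mu$: $\mu(x,x)=1$, $\mu(x,y)=-\sum_{x\preceq z\prec y}\mu(x,z)$ for $x\prec y$, $\mu(x,y)=0$ if $x\not\preceq y$. For $h:P\to\mathbb{C}$, $h_d$ is an incidence function with $h_d(\hat 0,z)=h(z)$, so $(h_d*\mu)(\hat 0,z)=\sum_{w\preceq z}h(w)\mu(w,z)$. For $S=\{x_1,\ldots,x_n\}$, $\Delta_i(h)=\sum(h_d*\mu)(\hat 0,z)$ over all $z\in P$ with $z\preceq x_i$ and $z\not\preceq x_j$ for every $j<i$. Meet matrix $(S)_f$: $(i,j)$ entry $f(x_i\wedge x_j)$; join matrix $[S]_f$: $(i,j)$ entry $f(x_i\vee x_j)$. $S$ is meet closed if $x\wedge y\in S$ for all $x,y\in S$. $f$ is semimultiplicative if $f(x\wedge y)f(x\vee y)=f(x)f(y)$ for all $x,y$. $K(n)$ is the set of $n\times n$ lower triangular $0$-$1$ matrices with all diagonal entries $1$; $c_n=\min\{\lambda: X\in K(n),\ \lambda \text{ the smallest eigenvalue of } XX^{\mathrm T}\}$ and $C_n=\max\{\lambda: X\in K(n),\ \lambda\text{ the largest eigenvalue of }XX^{\mathrm T}\}$. *)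

theory Defs
  imports Complex_Main "Jordan_Normal_Form.Spectral_Radius"
begin

class locally_finite_order = order +
  assumes finite_interval: "finite {a..b}"

definition incidence_function :: "('a::order \<Rightarrow> 'a \<Rightarrow> complex) \<Rightarrow> bool" where
  "incidence_function h \<longleftrightarrow> (\<forall>x y. \<not> x \<le> y \<longrightarrow> h x y = 0)"

definition convolution ::
  "('a::locally_finite_order \<Rightarrow> 'a \<Rightarrow> complex) \<Rightarrow> ('a \<Rightarrow> 'a \<Rightarrow> complex) \<Rightarrow> 'a \<Rightarrow> 'a \<Rightarrow> complex"
  where "convolution h k x y = (\<Sum>z\<in>{x..y}. h x z * k z y)"

function moebius :: "'a::locally_finite_order \<Rightarrow> 'a \<Rightarrow> complex" where
  "moebius x y = (if x = y then 1 else if x < y then - (\<Sum>z\<in>{x..<y}. moebius x z) else 0)"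
  by pat_completeness auto
termination
proof (relation "measure (\<lambda>(x, y). card {x..y})")
  fix x y z :: 'a
  assume "x \<noteq> y" "x < y" "z \<in> {x..<y}"
  then have "{x..z} \<subset> {x..y}"
    by (auto simp: less_le_not_le)
  then show "((x, z), (x, y)) \<in> measure (\<lambda>(x, y). card {x..y})"
    by (simp add: psubset_card_mono finite_interval)
qed simp

declare moebius.simps [simp del]

text \<open>
  Only the values of the incidence function \<open>h\<^sub>d\<close> at \<open>(\<bottom>, z)\<close> are prescribed;
  here all other values are taken to be 0. The lemma \<open>convolution_bot_cong\<close> below shows that
  the choice does not matter.
\<close>

definition lift_bot :: "('a::order_bot \<Rightarrow> complex) \<Rightarrow> 'a \<Rightarrow> 'a \<Rightarrow> complex" where
  "lift_bot h x z = (if x = bot then h z else 0)"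

lemma incidence_function_lift_bot: "incidence_function (lift_bot h)"
  by (auto simp: incidence_function_def lift_bot_def)

lemma incidence_function_moebius: "incidence_function moebius"
  unfolding incidence_function_def by (subst moebius.simps) auto

lemma convolution_lift_bot:
  fixes h :: "'a::{locally_finite_order, order_bot} \<Rightarrow> complex"
  shows "convolution (lift_bot h) k bot z = (\<Sum>w\<in>{..z}. h w * k w z)"
proof -
  have "{bot..z} = {..z}" by auto
  then show ?thesis by (simp add: convolution_def lift_bot_def)
qed

lemma convolution_bot_cong:
  fixes h :: "'a::{locally_finite_order, order_bot} \<Rightarrow> complex"
  assumes "\<And>w. h' bot w = h w"
  shows "convolution h' k bot z = convolution (lift_bot h) k bot z"
  using assms by (simp add: convolution_def lift_bot_def)

text \<open>
  The elements of \<open>S\<close> are indexed by \<open>0, \<dots>, n - 1\<close>, matching the indexing of matrices.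
\<close>

definition Delta ::
  "(nat \<Rightarrow> 'a::{locally_finite_order, order_bot}) \<Rightarrow> ('a \<Rightarrow> complex) \<Rightarrow> nat \<Rightarrow> complex" where
  "Delta x h i =
    (\<Sum>z | z \<le> x i \<and> (\<forall>j<i. \<not> z \<le> x j). convolution (lift_bot h) moebius bot z)"

lemma finite_Delta_range:
  fixes x :: "nat \<Rightarrow> 'a::{locally_finite_order, order_bot}"
  shows "finite {z. z \<le> x i \<and> (\<forall>j<i. \<not> z \<le> x j)}"
  by (rule finite_subset [OF _ finite_interval [of bot "x i"]]) auto

definition meet_matrix :: "nat \<Rightarrow> (nat \<Rightarrow> 'a::lattice) \<Rightarrow> ('a \<Rightarrow> complex) \<Rightarrow> complex mat" where
  "meet_matrix n x f = mat n n (\<lambda>(i, j). f (inf (x i) (x j)))"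

definition join_matrix :: "nat \<Rightarrow> (nat \<Rightarrow> 'a::lattice) \<Rightarrow> ('a \<Rightarrow> complex) \<Rightarrow> complex mat" where
  "join_matrix n x f = mat n n (\<lambda>(i, j). f (sup (x i) (x j)))"

definition meet_closed :: "'a::lattice set \<Rightarrow> bool" where
  "meet_closed S \<longleftrightarrow> (\<forall>x\<in>S. \<forall>y\<in>S. inf x y \<in> S)"

definition semimultiplicative :: "('a::lattice \<Rightarrow> complex) \<Rightarrow> bool" where
  "semimultiplicative f \<longleftrightarrow> (\<forall>x y. f (inf x y) * f (sup x y) = f x * f y)"

definition K :: "nat \<Rightarrow> real mat set" where
  "K n = {X \<in> carrier_mat n n.
    (\<forall>i<n. \<forall>j<n. X $$ (i, j) \<in> {0, 1}) \<and>
    (\<forall>i<n. \<forall>j<n. i < j \<longrightarrow> X $$ (i, j) = 0) \<and>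
    (\<forall>i<n. X $$ (i, i) = 1)}"

text \<open>
  Being real symmetric, \<open>X X\<^sup>T\<close> has only real eigenvalues, so its spectrum as a real matrix
  is its full spectrum.
\<close>

definition c_min :: "nat \<Rightarrow> real" where
  "c_min n = Min ((\<lambda>X. Min (spectrum (X * transpose_mat X))) ` K n)"

definition C_max :: "nat \<Rightarrow> real" where
  "C_max n = Max ((\<lambda>X. Max (spectrum (X * transpose_mat X))) ` K n)"

definition is_gen_eigenvalue :: "nat \<Rightarrow> complex mat \<Rightarrow> complex mat \<Rightarrow> complex \<Rightarrow> bool" where
  "is_gen_eigenvalue n A B l \<longleftrightarrow>
    (\<exists>v \<in> carrier_vec n. v \<noteq> 0\<^sub>v n \<and> A *\<^sub>v v = l \<cdot>\<^sub>v (B *\<^sub>v v))"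

end

theory Submission
  imports Defs
begin

text \<open>
  Let \<open>E\<close> be the 0-1 matrix of the order restricted to \<open>S\<close>; it lies in \<open>K n\<close>.
  Moebius inversion and meet closure give \<open>(S)\<^sub>f = E D\<^sub>f E\<^sup>T\<close> with \<open>D\<^sub>f\<close> the diagonal matrix of the
  \<open>Delta x f i\<close>, and semimultiplicativity gives \<open>[S]\<^sub>f = F E D\<^sub>g E\<^sup>T F\<close> with \<open>F\<close> the diagonal
  matrix of the \<open>f (x i)\<close>. Multiplication by \<open>E\<close> or \<open>E\<^sup>T\<close> changes the squared Euclidean norm
  by a factor between \<open>c_min n\<close> and \<open>C_max n\<close>, so both bounds follow by comparing the norms
  of the two sides of \<open>E D\<^sub>f E\<^sup>T v = l F E D\<^sub>g E\<^sup>T F v\<close>.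

  The Rayleigh bounds need no compactness: if \<open>m\<close> is the infimum of the Rayleigh quotient of
  a symmetric \<open>A\<close> and \<open>A - m I\<close> were invertible, its nonnegative form would be bounded away from
  zero, contradicting the choice of \<open>m\<close>.
\<close>

subsection \<open>Extremal eigenvalues of symmetric quadratic forms\<close>

lemma scalar_prod_self_nonneg:
  fixes v :: "real vec"
  shows "0 \<le> v \<bullet> v"
  by (simp add: scalar_prod_def sum_nonneg)

lemma scalar_prod_self_pos:
  fixes v :: "real vec"
  assumes "v \<in> carrier_vec n" "v \<noteq> 0\<^sub>v n"
  shows "0 < v \<bullet> v"
  using conjugate_square_greater_0_vec[OF assms(1)] assms(2) by simp

text \<open>Crude entrywise bound, from \<open>|v_i| |v_j| <= v . v\<close>. It supplies both a
  starting point for the supremum of Rayleigh lower bounds and a bound on the form of an inverse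
  matrix.\<close>

lemma quadratic_form_bounded:
  fixes A :: "real mat"
  assumes A: "A \<in> carrier_mat n n"
  obtains B where "B > 0" "\<And>v. v \<in> carrier_vec n \<Longrightarrow> \<bar>v \<bullet> (A *\<^sub>v v)\<bar> \<le> B * (v \<bullet> v)"
proof
  \<comment> \<open>The added 1 keeps \<open>B\<close> positive even for the zero matrix, so that it
    may be inverted later.\<close>
  define B where "B = (\<Sum>i = 0..<n. \<Sum>j = 0..<n. \<bar>A $$ (i, j)\<bar>) + 1"
  have "0 \<le> (\<Sum>i = 0..<n. \<Sum>j = 0..<n. \<bar>A $$ (i, j)\<bar>)"
    by (intro sum_nonneg) auto
  then show "B > 0" by (simp add: B_def)
  fix v :: "real vec" assume v: "v \<in> carrier_vec n"
  have sq: "(v $ i)\<^sup>2 \<le> v \<bullet> v" if "i < n" for i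
  proof -
    have "(v $ i)\<^sup>2 \<le> (\<Sum>k = 0..<n. (v $ k)\<^sup>2)"
      using that by (intro member_le_sum) auto
    then show ?thesis using v by (simp add: scalar_prod_def power2_eq_square)
  qed
  have prod: "\<bar>v $ i\<bar> * \<bar>v $ j\<bar> \<le> v \<bullet> v" if "i < n" "j < n" for i j
  proof -
    have "2 * (\<bar>v $ i\<bar> * \<bar>v $ j\<bar>) \<le> (v $ i)\<^sup>2 + (v $ j)\<^sup>2"
      using sum_squares_bound[of "\<bar>v $ i\<bar>" "\<bar>v $ j\<bar>"] by simp
    with sq[OF that(1)] sq[OF that(2)] show ?thesis by linarith
  qed
  have "v \<bullet> (A *\<^sub>v v) = (\<Sum>i = 0..<n. \<Sum>j = 0..<n. A $$ (i, j) * (v $ i * v $ j))"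
    using A v by (simp add: scalar_prod_def sum_distrib_left ac_simps)
  then have "\<bar>v \<bullet> (A *\<^sub>v v)\<bar> = \<bar>\<Sum>i = 0..<n. \<Sum>j = 0..<n. A $$ (i, j) * (v $ i * v $ j)\<bar>"
    by simp
  also have "\<dots> \<le> (\<Sum>i = 0..<n. \<Sum>j = 0..<n. \<bar>A $$ (i, j) * (v $ i * v $ j)\<bar>)"
    by (intro order_trans[OF sum_abs] sum_mono) auto
  also have "\<dots> \<le> (\<Sum>i = 0..<n. \<Sum>j = 0..<n. \<bar>A $$ (i, j)\<bar> * (v \<bullet> v))"
    using prod by (intro sum_mono) (auto simp: abs_mult intro!: mult_left_mono)
  also have "\<dots> \<le> B * (v \<bullet> v)"
    using scalar_prod_self_nonneg[of v] by (simp add: B_def sum_distrib_left sum_distrib_right algebra_simps)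
  finally show "\<bar>v \<bullet> (A *\<^sub>v v)\<bar> \<le> B * (v \<bullet> v)" .
qed

text \<open>The constant comes from the inverse \<open>M\<close> of \<open>A\<close>: if
  \<open>B\<close> bounds the form of \<open>M\<close>, then \<open>k = 1 / B\<close> works.
  Symmetry of \<open>A\<close> turns the cross terms into multiples of \<open>v . v\<close>.\<close>

lemma nonneg_form_coercive:
  fixes A :: "real mat"
  assumes A: "A \<in> carrier_mat n n" and sym: "transpose_mat A = A"
    and nonneg: "\<And>v. v \<in> carrier_vec n \<Longrightarrow> 0 \<le> v \<bullet> (A *\<^sub>v v)"
    and det: "det A \<noteq> 0"
  obtains k where "k > 0" "\<And>v. v \<in> carrier_vec n \<Longrightarrow> k * (v \<bullet> v) \<le> v \<bullet> (A *\<^sub>v v)"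
proof -
  obtain M where M: "M \<in> carrier_mat n n" "A * M = 1\<^sub>m n"
    using det_non_zero_imp_unit[OF A det, of "()"] by (auto simp: Units_def ring_mat_def)
  obtain B where B: "B > 0" "\<And>v. v \<in> carrier_vec n \<Longrightarrow> \<bar>v \<bullet> (M *\<^sub>v v)\<bar> \<le> B * (v \<bullet> v)"
    using quadratic_form_bounded[OF M(1)] by blast
  have "1 / B * (v \<bullet> v) \<le> v \<bullet> (A *\<^sub>v v)" if v: "v \<in> carrier_vec n" for v
  proof -
    define u where "u = M *\<^sub>v v"
    have u: "u \<in> carrier_vec n" using M v by (simp add: u_def)
    have Au: "A *\<^sub>v u = v"
      using assoc_mult_mat_vec[OF A M(1) v] M v by (simp add: u_def)
    have uAv: "u \<bullet> (A *\<^sub>v v) = v \<bullet> v"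
      using transpose_vec_mult_scalar[OF A v u] Au sym by simp
    let ?t = "1 / B"
    \<comment> \<open>Nonnegativity at \<open>v - t A\<^sup>-\<^sup>1 v\<close> does the work of Cauchy-Schwarz for the form.\<close>
    let ?w = "v - ?t \<cdot>\<^sub>v u"
    have "A *\<^sub>v ?w = A *\<^sub>v v - ?t \<cdot>\<^sub>v v"
      using A u v Au by (simp add: mult_minus_distrib_mat_vec mult_mat_vec)
    moreover have "u \<bullet> v = v \<bullet> u" using u v by (rule comm_scalar_prod)
    ultimately have "?w \<bullet> (A *\<^sub>v ?w) = v \<bullet> (A *\<^sub>v v) - 2 * ?t * (v \<bullet> v) + ?t\<^sup>2 * (v \<bullet> u)"
      using u v A uAv
      by (simp add: minus_scalar_prod_distrib[of _ n] scalar_prod_minus_distrib[of _ n]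
          power2_eq_square algebra_simps)
    moreover have "0 \<le> ?w \<bullet> (A *\<^sub>v ?w)" using u v by (intro nonneg) simp
    moreover have "?t\<^sup>2 * (v \<bullet> u) \<le> ?t\<^sup>2 * (B * (v \<bullet> v))"
      using B(2)[OF v] by (intro mult_left_mono) (auto simp: u_def)
    moreover have "?t\<^sup>2 * (B * (v \<bullet> v)) = ?t * (v \<bullet> v)"
      using B(1) by (simp add: power2_eq_square)
    ultimately show ?thesis by linarith
  qed
  then show thesis using B(1) that[of "1 / B"] by simp
qed

lemma symmetric_form_lower_eigenvalue:
  fixes A :: "real mat"
  assumes A: "A \<in> carrier_mat n n" and sym: "transpose_mat A = A" and n: "n > 0"
  obtains m where "eigenvalue A m" "\<And>v. v \<in> carrier_vec n \<Longrightarrow> m * (v \<bullet> v) \<le> v \<bullet> (A *\<^sub>v v)"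
proof -
  define T where "T = {t. \<forall>v\<in>carrier_vec n. t * (v \<bullet> v) \<le> v \<bullet> (A *\<^sub>v v)}"
  obtain B where B: "B > 0" "\<And>v. v \<in> carrier_vec n \<Longrightarrow> \<bar>v \<bullet> (A *\<^sub>v v)\<bar> \<le> B * (v \<bullet> v)"
    using quadratic_form_bounded[OF A] by blast
  have "- B \<in> T" using B(2) unfolding T_def by (force simp: abs_le_iff)
  define e :: "real vec" where "e = unit_vec n 0"
  have e: "e \<in> carrier_vec n" "e \<bullet> e = 1" using n by (simp_all add: e_def)
  \<comment> \<open>Testing at one unit vector bounds \<open>T\<close> from above. Here
    \<open>n > 0\<close> enters: in dimension 0 every real lies in \<open>T\<close>.\<close>
  have bdd: "bdd_above T"
    using e by (intro bdd_aboveI[of _ "e \<bullet> (A *\<^sub>v e)"]) (auto simp: T_def)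
  define m where "m = Sup T"
  have m: "m * (v \<bullet> v) \<le> v \<bullet> (A *\<^sub>v v)" if v: "v \<in> carrier_vec n" for v
  proof (cases "v = 0\<^sub>v n")
    case True
    then show ?thesis using A by (simp add: scalar_prod_def)
  next
    case False
    then have pos: "v \<bullet> v > 0" using scalar_prod_self_pos v by blast
    have "m \<le> v \<bullet> (A *\<^sub>v v) / (v \<bullet> v)"
      unfolding m_def using \<open>- B \<in> T\<close> v pos
      by (intro cSup_least) (blast, auto simp: T_def field_simps)
    then show ?thesis using pos by (simp add: field_simps)
  qed
  \<comment> \<open>This is A - m I, whose form is nonnegative because \<open>m\<close> is itself a
    lower Rayleigh bound.\<close>
  let ?C = "char_matrix A m"
  have form: "v \<bullet> (?C *\<^sub>v v) = v \<bullet> (A *\<^sub>v v) - m * (v \<bullet> v)" if "v \<in> carrier_vec n" for v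
  proof -
    have "?C *\<^sub>v v = A *\<^sub>v v + (- m) \<cdot>\<^sub>v v"
      using A that by (intro eq_vecI) (auto simp: char_matrix_def add_scalar_prod_distrib[of _ n])
    then show ?thesis using A that by (simp add: scalar_prod_add_distrib[of _ n])
  qed
  have "det ?C = 0"
  proof (rule ccontr)
    assume "det ?C \<noteq> 0"
    moreover have "transpose_mat ?C = ?C"
    proof (rule eq_matI)
      fix i j assume "i < dim_row ?C" "j < dim_col ?C"
      then show "transpose_mat ?C $$ (i, j) = ?C $$ (i, j)"
        using A arg_cong[OF sym, of "\<lambda>M. M $$ (i, j)"] by (auto simp: char_matrix_def)
    qed (use A in \<open>auto simp: char_matrix_def\<close>)
    moreover have "0 \<le> v \<bullet> (?C *\<^sub>v v)" if "v \<in> carrier_vec n" for v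
      using m[OF that] form[OF that] by simp
    ultimately obtain k where k: "k > 0"
        "\<And>v. v \<in> carrier_vec n \<Longrightarrow> k * (v \<bullet> v) \<le> v \<bullet> (?C *\<^sub>v v)"
      using nonneg_form_coercive[of ?C n] A by auto
    \<comment> \<open>Coercivity with constant \<open>k\<close> would improve the lower bound
      \<open>m\<close> to \<open>m + k\<close>, past the supremum.\<close>
    then have "m + k \<in> T" unfolding T_def using form by (force simp: algebra_simps)
    then have "m + k \<le> m" unfolding m_def by (rule cSup_upper[OF _ bdd])
    with k show False by simp
  qed
  then have "eigenvalue A m" using eigenvalue_det[OF A] by simp
  with m that show thesis by blast
qed

text \<open>Negating the matrix exchanges the two ends of the spectrum, so the lower bound for
  \<open>- A\<close> suffices.\<close>

lemma symmetric_form_upper_eigenvalue: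
  fixes A :: "real mat"
  assumes A: "A \<in> carrier_mat n n" and sym: "transpose_mat A = A" and n: "n > 0"
  obtains m where "eigenvalue A m" "\<And>v. v \<in> carrier_vec n \<Longrightarrow> v \<bullet> (A *\<^sub>v v) \<le> m * (v \<bullet> v)"
proof -
  have "transpose_mat (- A) = - A"
    using sym by (simp add: transpose_uminus)
  then obtain m where m: "eigenvalue (- A) m"
      "\<And>v. v \<in> carrier_vec n \<Longrightarrow> m * (v \<bullet> v) \<le> v \<bullet> ((- A) *\<^sub>v v)"
    using symmetric_form_lower_eigenvalue[of "- A" n] A n by auto
  obtain u where u: "u \<in> carrier_vec n" "u \<noteq> 0\<^sub>v n" "(- A) *\<^sub>v u = m \<cdot>\<^sub>v u"
    using m(1) A by (auto simp: eigenvalue_def eigenvector_def)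
  have "A *\<^sub>v u = (- m) \<cdot>\<^sub>v u"
  proof (rule eq_vecI)
    fix i assume "i < dim_vec ((- m) \<cdot>\<^sub>v u)"
    then show "(A *\<^sub>v u) $ i = ((- m) \<cdot>\<^sub>v u) $ i"
      using A u(1) arg_cong[OF u(3), of "\<lambda>w. w $ i"] by simp
  qed (use A u in auto)
  then have "eigenvalue A (- m)"
    using u A by (auto simp: eigenvalue_def eigenvector_def)
  moreover have "v \<bullet> (A *\<^sub>v v) \<le> - m * (v \<bullet> v)" if "v \<in> carrier_vec n" for v
    using m(2)[OF that] A that by (simp add: uminus_mult_mat_vec)
  ultimately show thesis using that by blast
qed

subsection \<open>Norm bounds for triangular 0-1 matrices\<close>

text \<open>Needed for the \<open>Min\<close> and \<open>Max\<close> over \<open>K n\<close> in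
  \<open>c_min\<close> and \<open>C_max\<close> to be genuine extrema. A member is determined by a
  0-1 function on a finite index square.\<close>

lemma finite_K: "finite (K n)"
proof (rule finite_subset)
  let ?I = "{..<n} \<times> {..<n}"
  show "K n \<subseteq> mat n n ` PiE ?I (\<lambda>_. {0, 1})"
  proof
    fix X :: "real mat" assume X: "X \<in> K n"
    \<comment> \<open>Restriction makes the entry function extensional, as \<open>PiE\<close>
      demands; \<open>mat n n\<close> reads no value outside the square.\<close>
    let ?h = "restrict (\<lambda>p. X $$ p) ?I"
    have "X = mat n n ?h" using X by (intro eq_matI) (auto simp: K_def)
    moreover have "?h \<in> PiE ?I (\<lambda>_. {0, 1})" using X by (auto simp: K_def)
    ultimately show "X \<in> mat n n ` PiE ?I (\<lambda>_. {0, 1})" by blast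
  qed
  show "finite (mat n n ` PiE ?I (\<lambda>_. {0, 1 :: real}))"
    by (intro finite_imageI finite_PiE) auto
qed

lemma one_mat_in_K: "1\<^sub>m n \<in> K n"
  by (auto simp: K_def)

lemma det_K:
  assumes "X \<in> K n"
  shows "det X \<noteq> 0"
  using det_lower_triangular[of n X] assms
  by (auto simp: K_def diag_mat_def prod_list_zero_iff)

context
  fixes X :: "real mat" and n :: nat
  assumes X: "X \<in> K n" and n: "n > 0"
begin

private lemma X_carrier: "X \<in> carrier_mat n n"
  using X by (simp add: K_def)

private lemma gram_carrier: "X * transpose_mat X \<in> carrier_mat n n"
  using X_carrier by simp

private lemma gram_symmetric: "transpose_mat (X * transpose_mat X) = X * transpose_mat X"
  using X_carrier by (simp add: transpose_mult[of _ n n])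

private lemma gram_form:
  assumes v: "v \<in> carrier_vec n"
  shows "v \<bullet> ((X * transpose_mat X) *\<^sub>v v) = (transpose_mat X *\<^sub>v v) \<bullet> (transpose_mat X *\<^sub>v v)"
proof -
  have "(X * transpose_mat X) *\<^sub>v v = X *\<^sub>v (transpose_mat X *\<^sub>v v)"
    using X_carrier v by (simp add: assoc_mult_mat_vec[of _ n n])
  then show ?thesis
    using transpose_vec_mult_scalar[OF X_carrier, of "transpose_mat X *\<^sub>v v" v] X_carrier v by simp
qed

lemma finite_gram_spectrum: "finite (spectrum (X * transpose_mat X))"
  using card_finite_spectrum[OF gram_carrier] by simp

lemma gram_spectrum_nonempty: "spectrum (X * transpose_mat X) \<noteq> {}"
  using symmetric_form_lower_eigenvalue[OF gram_carrier gram_symmetric n]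
  by (auto simp: spectrum_def)

text \<open>For an eigenvector v, \<open>m\<close> times the squared norm of v equals the squared
  norm of its image under the transpose of \<open>X\<close>, which is nonzero because
  \<open>X\<close> is invertible.\<close>

lemma gram_spectrum_pos:
  assumes "m \<in> spectrum (X * transpose_mat X)"
  shows "m > 0"
proof -
  obtain v where v: "v \<in> carrier_vec n" "v \<noteq> 0\<^sub>v n"
      "(X * transpose_mat X) *\<^sub>v v = m \<cdot>\<^sub>v v"
    using assms X_carrier by (auto simp: spectrum_def eigenvalue_def eigenvector_def)
  have "transpose_mat X *\<^sub>v v \<noteq> 0\<^sub>v n"
    using det_K[OF X] det_transpose[OF X_carrier] v
      det_0_iff_vec_prod_zero[of "transpose_mat X" n] X_carrier by auto
  then have "0 < (transpose_mat X *\<^sub>v v) \<bullet> (transpose_mat X *\<^sub>v v)"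
    using X_carrier v by (intro scalar_prod_self_pos[of _ n]) auto
  then have "0 < m * (v \<bullet> v)"
    using gram_form[OF v(1)] v by simp
  with scalar_prod_self_nonneg[of v] show "m > 0" by (simp add: zero_less_mult_iff)
qed

lemma c_min_le_form:
  assumes v: "v \<in> carrier_vec n"
  shows "c_min n * (v \<bullet> v) \<le> (transpose_mat X *\<^sub>v v) \<bullet> (transpose_mat X *\<^sub>v v)"
proof -
  obtain m where m: "eigenvalue (X * transpose_mat X) m"
      "m * (v \<bullet> v) \<le> v \<bullet> ((X * transpose_mat X) *\<^sub>v v)"
    using symmetric_form_lower_eigenvalue[OF gram_carrier gram_symmetric n] v by metis
  have "c_min n \<le> Min (spectrum (X * transpose_mat X))"
    unfolding c_min_def using X finite_K by (intro Min_le) auto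
  also have "\<dots> \<le> m"
    using m(1) finite_gram_spectrum by (intro Min_le) (auto simp: spectrum_def)
  finally have "c_min n * (v \<bullet> v) \<le> m * (v \<bullet> v)"
    using scalar_prod_self_nonneg by (rule mult_right_mono)
  with m(2) gram_form[OF v] show ?thesis by simp
qed

lemma form_le_C_max:
  assumes v: "v \<in> carrier_vec n"
  shows "(transpose_mat X *\<^sub>v v) \<bullet> (transpose_mat X *\<^sub>v v) \<le> C_max n * (v \<bullet> v)"
proof -
  obtain m where m: "eigenvalue (X * transpose_mat X) m"
      "v \<bullet> ((X * transpose_mat X) *\<^sub>v v) \<le> m * (v \<bullet> v)"
    using symmetric_form_upper_eigenvalue[OF gram_carrier gram_symmetric n] v by metis
  have "m \<le> Max (spectrum (X * transpose_mat X))"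
    using m(1) finite_gram_spectrum by (intro Max_ge) (auto simp: spectrum_def)
  also have "\<dots> \<le> C_max n"
    unfolding C_max_def using X finite_K by (intro Max_ge) auto
  finally have "m * (v \<bullet> v) \<le> C_max n * (v \<bullet> v)"
    using scalar_prod_self_nonneg by (rule mult_right_mono)
  with m(2) gram_form[OF v] show ?thesis by simp
qed

end

text \<open>The minimum over a finite family is attained, so \<open>c_min n\<close> is itself an
  eigenvalue of some Gram matrix and inherits positivity.\<close>

lemma c_min_pos:
  assumes n: "n > 0"
  shows "c_min n > 0"
proof -
  have "c_min n \<in> (\<lambda>X. Min (spectrum (X * transpose_mat X))) ` K n"
    unfolding c_min_def using one_mat_in_K finite_K by (intro Min_in) auto
  then obtain X where X: "X \<in> K n" "c_min n = Min (spectrum (X * transpose_mat X))"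
    by auto
  then have "c_min n \<in> spectrum (X * transpose_mat X)"
    using Min_in[OF finite_gram_spectrum gram_spectrum_nonempty, OF X(1) n X(1) n] by simp
  then show ?thesis by (rule gram_spectrum_pos[OF X(1) n])
qed

lemma C_max_pos:
  assumes n: "n > 0"
  shows "C_max n > 0"
proof -
  let ?e = "unit_vec n 0 :: real vec"
  \<comment> \<open>Chaining the two form bounds for the identity matrix at a unit vector gives
    \<open>c_min n <= C_max n\<close>.\<close>
  have "c_min n * (?e \<bullet> ?e) \<le> C_max n * (?e \<bullet> ?e)"
    by (rule order_trans[OF c_min_le_form form_le_C_max, OF one_mat_in_K n _ one_mat_in_K n])
      (use n in auto)
  with c_min_pos[OF n] n show ?thesis by simp
qed

text \<open>Squared Euclidean norm of a complex vector, represented by its coordinate function and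
  read only below \<open>n\<close>.\<close>

definition sq_norm_upto :: "nat \<Rightarrow> (nat \<Rightarrow> complex) \<Rightarrow> real" where
  "sq_norm_upto n w = (\<Sum>i<n. (cmod (w i))\<^sup>2)"

text \<open>A real matrix acts separately on real and imaginary parts, and squared norms add over
  the two, so the real bounds carry over.\<close>

lemma K_transpose_sq_norm:
  assumes X: "X \<in> K n" and n: "n > 0"
  shows "c_min n * sq_norm_upto n w
      \<le> sq_norm_upto n (\<lambda>j. \<Sum>i<n. complex_of_real (X $$ (i, j)) * w i)" (is ?lower)
    and "sq_norm_upto n (\<lambda>j. \<Sum>i<n. complex_of_real (X $$ (i, j)) * w i)
      \<le> C_max n * sq_norm_upto n w" (is ?upper)
proof -
  have cX: "X \<in> carrier_mat n n" using X by (simp add: K_def)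
  let ?a = "vec n (\<lambda>i. Re (w i))" and ?b = "vec n (\<lambda>i. Im (w i))"
  let ?Q = "\<lambda>v. (transpose_mat X *\<^sub>v v) \<bullet> (transpose_mat X *\<^sub>v v)"
  have w: "sq_norm_upto n w = ?a \<bullet> ?a + ?b \<bullet> ?b"
    by (simp add: sq_norm_upto_def scalar_prod_def cmod_power2 sum.distrib
        atLeast0LessThan power2_eq_square[symmetric])
  have Xw: "sq_norm_upto n (\<lambda>j. \<Sum>i<n. complex_of_real (X $$ (i, j)) * w i) = ?Q ?a + ?Q ?b"
    using cX by (simp add: sq_norm_upto_def scalar_prod_def cmod_power2 sum.distrib
        atLeast0LessThan power2_eq_square[symmetric])
  show ?lower
    using c_min_le_form[OF X n, of ?a] c_min_le_form[OF X n, of ?b]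
    unfolding w Xw by (simp add: algebra_simps)
  show ?upper
    using form_le_C_max[OF X n, of ?a] form_le_C_max[OF X n, of ?b]
    unfolding w Xw by (simp add: algebra_simps)
qed

text \<open>Transposition along the antidiagonal preserves \<open>K n\<close> and exchanges the two products.\<close>

lemma K_sq_norm:
  assumes X: "X \<in> K n" and n: "n > 0"
  shows "c_min n * sq_norm_upto n w
      \<le> sq_norm_upto n (\<lambda>i. \<Sum>j<n. complex_of_real (X $$ (i, j)) * w j)" (is ?lower)
    and "sq_norm_upto n (\<lambda>i. \<Sum>j<n. complex_of_real (X $$ (i, j)) * w j)
      \<le> C_max n * sq_norm_upto n w" (is ?upper)
proof -
  define r where "r i = n - Suc i" for i
  have r: "r i < n" "r (r i) = i" if "i < n" for i
    using that by (auto simp: r_def)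
  define Y where "Y = mat n n (\<lambda>(i, j). X $$ (r j, r i))"
  have Y: "Y \<in> K n"
    using X r unfolding K_def Y_def by (auto simp: r_def)
  have w: "sq_norm_upto n (w \<circ> r) = sq_norm_upto n w"
    unfolding sq_norm_upto_def o_def r_def by (rule sum.nat_diff_reindex)
  have "sq_norm_upto n (\<lambda>j. \<Sum>i<n. complex_of_real (Y $$ (i, j)) * (w \<circ> r) i)
      = (\<Sum>j<n. (cmod (\<Sum>i<n. complex_of_real (X $$ (r j, r i)) * w (r i)))\<^sup>2)"
    by (simp add: sq_norm_upto_def Y_def)
  also have "\<dots> = (\<Sum>j<n. (cmod (\<Sum>i<n. complex_of_real (X $$ (r j, i)) * w i))\<^sup>2)"
    unfolding r_def
    by (subst sum.nat_diff_reindex[of "\<lambda>i. complex_of_real (X $$ (_, i)) * w i"]) (rule refl)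
  also have "\<dots> = sq_norm_upto n (\<lambda>i. \<Sum>j<n. complex_of_real (X $$ (i, j)) * w j)"
    unfolding sq_norm_upto_def r_def by (rule sum.nat_diff_reindex)
  finally have Yw: "sq_norm_upto n (\<lambda>j. \<Sum>i<n. complex_of_real (Y $$ (i, j)) * (w \<circ> r) i)
      = sq_norm_upto n (\<lambda>i. \<Sum>j<n. complex_of_real (X $$ (i, j)) * w j)" .
  show ?lower ?upper
    using K_transpose_sq_norm[OF Y n, of "w \<circ> r"] unfolding w Yw .
qed

subsection \<open>Factorization of meet and join matrices\<close>

lemma finite_atMost_locally_finite:
  "finite {..y :: 'a::{locally_finite_order, order_bot}}"
  using finite_interval[of bot y] by (rule rev_finite_subset) auto

text \<open>The recursion defining \<open>moebius\<close>, read as the statement that convolving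
  \<open>moebius\<close> with the zeta function gives the identity.\<close>

lemma sum_moebius:
  fixes w y :: "'a::locally_finite_order"
  assumes "w \<le> y"
  shows "(\<Sum>z\<in>{w..y}. moebius w z) = (if w = y then 1 else 0)"
proof (cases "w = y")
  case True
  then show ?thesis by (simp add: moebius.simps)
next
  case False
  with assms have "w < y" by simp
  then have "{w..y} = insert y {w..<y}" by (auto simp: le_less)
  moreover have "finite {w..<y}"
    using finite_interval[of w y] by (rule rev_finite_subset) auto
  ultimately have "(\<Sum>z\<in>{w..y}. moebius w z) = moebius w y + (\<Sum>z\<in>{w..<y}. moebius w z)"
    by simp
  then show ?thesis using \<open>w < y\<close> by (simp add: moebius.simps[of w y])
qed

lemma moebius_inversion_bot:
  fixes h :: "'a::{locally_finite_order, order_bot} \<Rightarrow> complex"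
  shows "(\<Sum>z\<le>y. convolution (lift_bot h) moebius bot z) = h y"
proof -
  have fin: "finite {..y}" by (rule finite_atMost_locally_finite)
  have zero: "moebius w z = 0" if "\<not> w \<le> z" for w z :: 'a
    using incidence_function_moebius that by (auto simp: incidence_function_def)
  \<comment> \<open>Since \<open>moebius w z\<close> vanishes unless w is below z, the inner range
    can be enlarged to everything below \<open>y\<close>; the two ranges become independent and the
    sums can be swapped.\<close>
  have "(\<Sum>z\<le>y. convolution (lift_bot h) moebius bot z) = (\<Sum>z\<le>y. \<Sum>w\<le>y. h w * moebius w z)"
    unfolding convolution_lift_bot
    by (intro sum.cong refl sum.mono_neutral_left fin) (auto simp: zero)
  also have "\<dots> = (\<Sum>w\<le>y. h w * (\<Sum>z\<le>y. moebius w z))"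
    by (subst sum.swap) (simp add: sum_distrib_left)
  also have "\<dots> = (\<Sum>w\<le>y. h w * (if w = y then 1 else 0))"
  proof (intro sum.cong refl)
    fix w assume w: "w \<in> {..y}"
    have "(\<Sum>z\<le>y. moebius w z) = (\<Sum>z\<in>{w..y}. moebius w z)"
      by (intro sum.mono_neutral_right fin) (auto simp: zero)
    then show "h w * (\<Sum>z\<le>y. moebius w z) = h w * (if w = y then 1 else 0)"
      using w sum_moebius[of w y] by simp
  qed
  also have "\<dots> = h y" using fin by (simp add: if_distrib cong: if_cong)
  finally show ?thesis .
qed

lemma meet_closed_index:
  assumes closed: "meet_closed (x ` {..<n})" and "i < n" "j < n"
  obtains m where "m < n" "x m = inf (x i) (x j)"
proof -
  have "inf (x i) (x j) \<in> x ` {..<n}"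
    using assms by (simp add: meet_closed_def)
  then show thesis using that by auto
qed

text \<open>
  Each \<open>z \<le> x m\<close> is counted by \<open>Delta\<close> exactly at the least \<open>k\<close> with \<open>z \<le> x k\<close>;
  since \<open>x k\<close> and \<open>x m\<close> have their meet in \<open>S\<close>, minimality of \<open>k\<close> forces \<open>x k \<le> x m\<close>.
\<close>

lemma sum_Delta:
  fixes x :: "nat \<Rightarrow> 'a::{locally_finite_order, bounded_lattice_bot}"
  assumes closed: "meet_closed (x ` {..<n})"
    and mono: "\<And>i j. i < n \<Longrightarrow> j < n \<Longrightarrow> x i \<le> x j \<Longrightarrow> i \<le> j"
    and m: "m < n"
  shows "(\<Sum>k | k < n \<and> x k \<le> x m. Delta x h k) = h (x m)"
proof -
  let ?I = "{k. k < n \<and> x k \<le> x m}"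
  let ?A = "\<lambda>k. {z. z \<le> x k \<and> (\<forall>j<k. \<not> z \<le> x j)}"
  have "(\<Union>k\<in>?I. ?A k) = {..x m}"
  proof
    show "(\<Union>k\<in>?I. ?A k) \<subseteq> {..x m}" by (auto intro: order_trans)
    show "{..x m} \<subseteq> (\<Union>k\<in>?I. ?A k)"
    proof
      fix z assume z: "z \<in> {..x m}"
      define k where "k = (LEAST k. z \<le> x k)"
      have zk: "z \<le> x k" unfolding k_def using z by (auto intro: LeastI)
      have least: "k \<le> j" if "z \<le> x j" for j unfolding k_def using that by (rule Least_le)
      have k: "k < n" using least[of m] z m by simp
      obtain l where l: "l < n" "x l = inf (x k) (x m)"
        using meet_closed_index[OF closed k m] .
      \<comment> \<open>The indexing of S gives \<open>l <= k\<close> and minimality of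
        \<open>k\<close> gives \<open>k <= l\<close>, so the meet \<open>x l\<close> is
        \<open>x k\<close> itself.\<close>
      have "l \<le> k" using mono[OF l(1) k] l(2) by simp
      moreover have "k \<le> l" using least[of l] l(2) zk z by simp
      ultimately have "x k \<le> x m" using l(2) by (metis inf.cobounded2 le_antisym)
      moreover have "z \<in> ?A k" using zk least by force
      ultimately show "z \<in> (\<Union>k\<in>?I. ?A k)" using k by auto
    qed
  qed
  \<comment> \<open>Of two different indices, the larger one excludes every z lying below the
    element with the smaller index.\<close>
  moreover have "\<forall>i\<in>?I. \<forall>j\<in>?I. i \<noteq> j \<longrightarrow> ?A i \<inter> ?A j = {}"
    by (auto dest: nat_neq_iff[THEN iffD1])
  ultimately have "(\<Sum>k\<in>?I. Delta x h k) = (\<Sum>z\<le>x m. convolution (lift_bot h) moebius bot z)"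
    unfolding Delta_def
    by (subst sum.UNION_disjoint[symmetric]) (auto intro: finite_Delta_range)
  then show ?thesis by (simp add: moebius_inversion_bot)
qed

text \<open>Transpose of the zeta matrix of S; this orientation makes it lower triangular when the
  indexing respects the order.\<close>

definition incidence_matrix :: "nat \<Rightarrow> (nat \<Rightarrow> 'a::order) \<Rightarrow> real mat" where
  "incidence_matrix n x = mat n n (\<lambda>(i, k). if x k \<le> x i then 1 else 0)"

lemma incidence_matrix_in_K:
  assumes "\<And>i j. i < n \<Longrightarrow> j < n \<Longrightarrow> x i \<le> x j \<Longrightarrow> i \<le> j"
  shows "incidence_matrix n x \<in> K n"
  using assms by (fastforce simp: K_def incidence_matrix_def)

text \<open>Coordinate \<open>i\<close> of X D X^T w, where D is the diagonal matrix with entries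
  \<open>d\<close>.\<close>

definition congruence :: "nat \<Rightarrow> real mat \<Rightarrow> (nat \<Rightarrow> complex) \<Rightarrow> (nat \<Rightarrow> complex) \<Rightarrow> nat \<Rightarrow> complex"
  where "congruence n X d w i =
    (\<Sum>k<n. complex_of_real (X $$ (i, k)) * (d k * (\<Sum>j<n. complex_of_real (X $$ (j, k)) * w j)))"

text \<open>An element lies below a meet iff it lies below both arguments, so the indicator in
  \<open>sum_Delta\<close> splits into a product of two incidence entries. Leaving \<open>h\<close>
  arbitrary lets the factorization serve both \<open>f\<close> and \<open>g\<close>.\<close>

lemma sum_meet_eq_congruence:
  fixes x :: "nat \<Rightarrow> 'a::{locally_finite_order, bounded_lattice_bot}"
  assumes closed: "meet_closed (x ` {..<n})"
    and mono: "\<And>i j. i < n \<Longrightarrow> j < n \<Longrightarrow> x i \<le> x j \<Longrightarrow> i \<le> j"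
    and i: "i < n"
  shows "(\<Sum>j<n. h (inf (x i) (x j)) * w j) = congruence n (incidence_matrix n x) (Delta x h) w i"
proof -
  let ?e = "\<lambda>i k. complex_of_real (incidence_matrix n x $$ (i, k))"
  have h: "h (inf (x i) (x j)) = (\<Sum>k<n. ?e i k * ?e j k * Delta x h k)" if j: "j < n" for j
  proof -
    obtain m where m: "m < n" "x m = inf (x i) (x j)"
      using meet_closed_index[OF closed i j] .
    have "h (x m) = (\<Sum>k\<in>{k\<in>{..<n}. x k \<le> x m}. Delta x h k)"
      using sum_Delta[OF closed mono m(1), of h] by simp
    also have "\<dots> = (\<Sum>k<n. if x k \<le> x m then Delta x h k else 0)"
      by (rule sum.inter_filter) simp
    also have "\<dots> = (\<Sum>k<n. ?e i k * ?e j k * Delta x h k)"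
      using i j m(2) by (intro sum.cong) (auto simp: incidence_matrix_def)
    finally show ?thesis using m(2) by simp
  qed
  have "(\<Sum>j<n. h (inf (x i) (x j)) * w j) = (\<Sum>j<n. \<Sum>k<n. ?e i k * ?e j k * Delta x h k * w j)"
    using h by (simp add: sum_distrib_right)
  also have "\<dots> = (\<Sum>k<n. \<Sum>j<n. ?e i k * ?e j k * Delta x h k * w j)" by (rule sum.swap)
  also have "\<dots> = congruence n (incidence_matrix n x) (Delta x h) w i"
    by (simp add: congruence_def sum_distrib_left ac_simps)
  finally show ?thesis .
qed

section \<open>Norm bounds for the factored matrices\<close>

lemma sq_norm_upto_scale_le:
  assumes "\<And>k. k < n \<Longrightarrow> (cmod (d k))\<^sup>2 \<le> M"
  shows "sq_norm_upto n (\<lambda>k. d k * w k) \<le> M * sq_norm_upto n w"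
  unfolding sq_norm_upto_def sum_distrib_left norm_mult power_mult_distrib
  using assms by (intro sum_mono mult_right_mono) auto

lemma sq_norm_upto_scale_ge:
  assumes "\<And>k. k < n \<Longrightarrow> m \<le> (cmod (d k))\<^sup>2"
  shows "m * sq_norm_upto n w \<le> sq_norm_upto n (\<lambda>k. d k * w k)"
  unfolding sq_norm_upto_def sum_distrib_left norm_mult power_mult_distrib
  using assms by (intro sum_mono mult_right_mono) auto

text \<open>For squared norms X and its transpose each cost a factor \<open>C_max n\<close> and the
  diagonal costs the square of \<open>M\<close>, which together form a perfect square.\<close>

lemma sq_norm_congruence_le:
  assumes X: "X \<in> K n" and n: "n > 0" and M: "\<And>k. k < n \<Longrightarrow> cmod (d k) \<le> M"
  shows "sq_norm_upto n (congruence n X d w) \<le> (C_max n * M)\<^sup>2 * sq_norm_upto n w"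
proof -
  let ?u = "\<lambda>k. \<Sum>j<n. complex_of_real (X $$ (j, k)) * w j"
  have C: "C_max n \<ge> 0" using C_max_pos[OF n] by simp
  have "sq_norm_upto n (congruence n X d w) \<le> C_max n * sq_norm_upto n (\<lambda>k. d k * ?u k)"
    unfolding congruence_def by (rule K_sq_norm(2)[OF X n])
  also have "\<dots> \<le> C_max n * (M\<^sup>2 * sq_norm_upto n ?u)"
    using M C by (intro mult_left_mono sq_norm_upto_scale_le power_mono) auto
  also have "\<dots> \<le> C_max n * (M\<^sup>2 * (C_max n * sq_norm_upto n w))"
    using C by (intro mult_left_mono K_transpose_sq_norm(2)[OF X n]) auto
  finally show ?thesis by (simp add: power2_eq_square ac_simps)
qed

lemma sq_norm_congruence_ge:
  assumes X: "X \<in> K n" and n: "n > 0" and m: "m \<ge> 0" "\<And>k. k < n \<Longrightarrow> m \<le> cmod (d k)"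
  shows "(c_min n * m)\<^sup>2 * sq_norm_upto n w \<le> sq_norm_upto n (congruence n X d w)"
proof -
  let ?u = "\<lambda>k. \<Sum>j<n. complex_of_real (X $$ (j, k)) * w j"
  have c: "c_min n \<ge> 0" using c_min_pos[OF n] by simp
  have "(c_min n * m)\<^sup>2 * sq_norm_upto n w = c_min n * (m\<^sup>2 * (c_min n * sq_norm_upto n w))"
    by (simp add: power2_eq_square ac_simps)
  also have "\<dots> \<le> c_min n * (m\<^sup>2 * sq_norm_upto n ?u)"
    using c by (intro mult_left_mono K_transpose_sq_norm(1)[OF X n]) auto
  also have "\<dots> \<le> c_min n * sq_norm_upto n (\<lambda>k. d k * ?u k)"
    using m c by (intro mult_left_mono sq_norm_upto_scale_ge power_mono) auto
  also have "\<dots> \<le> sq_norm_upto n (congruence n X d w)"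
    unfolding congruence_def by (rule K_sq_norm(1)[OF X n])
  finally show ?thesis .
qed

text \<open>Turns the eigenvalue equation into one identity between squared norms, the only form in
  which the final estimates use it.\<close>

lemma gen_eigenvalue_sq_norm:
  fixes f g :: "'a::{locally_finite_order, bounded_lattice_bot} \<Rightarrow> complex"
  assumes semi: "semimultiplicative f" and f0: "\<And>z. f z \<noteq> 0" and g: "\<And>z. g z = 1 / f z"
    and closed: "meet_closed (x ` {..<n})"
    and mono: "\<And>i j. i < n \<Longrightarrow> j < n \<Longrightarrow> x i \<le> x j \<Longrightarrow> i \<le> j"
    and l: "is_gen_eigenvalue n (meet_matrix n x f) (join_matrix n x f) l"
  obtains w where "n > 0" "sq_norm_upto n w > 0"
    "sq_norm_upto n (congruence n (incidence_matrix n x) (Delta x f) w)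
      = (cmod l)\<^sup>2 * sq_norm_upto n (\<lambda>i. f (x i) *
          congruence n (incidence_matrix n x) (Delta x g) (\<lambda>j. f (x j) * w j) i)"
proof -
  let ?F = "congruence n (incidence_matrix n x)"
  obtain v where v: "v \<in> carrier_vec n" "v \<noteq> 0\<^sub>v n"
      "meet_matrix n x f *\<^sub>v v = l \<cdot>\<^sub>v (join_matrix n x f *\<^sub>v v)"
    using l by (auto simp: is_gen_eigenvalue_def)
  let ?w = "\<lambda>j. v $ j"
  \<comment> \<open>A nonzero coordinate yields both \<open>n > 0\<close> and a positive
    norm.\<close>
  obtain p where p: "p < n" "v $ p \<noteq> 0"
    using v(1,2) by (metis carrier_vecD eq_vecI index_zero_vec)
  have "(cmod (v $ p))\<^sup>2 \<le> sq_norm_upto n ?w"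
    unfolding sq_norm_upto_def using p by (intro member_le_sum) auto
  moreover have "(cmod (v $ p))\<^sup>2 > 0" using p by simp
  ultimately have pos: "sq_norm_upto n ?w > 0" by linarith
  \<comment> \<open>Semimultiplicativity solved for the value at the join: the join matrix becomes
    the meet matrix of \<open>g\<close>, scaled by \<open>f\<close> on both sides.\<close>
  have sup: "f (sup a b) = f a * (f b * g (inf a b))" for a b
  proof -
    have "f (inf a b) * f (sup a b) = f a * f b"
      using semi by (simp add: semimultiplicative_def)
    then show ?thesis using f0[of "inf a b"] by (simp add: g field_simps)
  qed
  have "?F (Delta x f) ?w i = l * (f (x i) * ?F (Delta x g) (\<lambda>j. f (x j) * ?w j) i)"
    if i: "i < n" for i
  proof -
    have "?F (Delta x f) ?w i = (\<Sum>j<n. f (inf (x i) (x j)) * v $ j)"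
      by (rule sum_meet_eq_congruence[OF closed mono i, symmetric])
    also have "\<dots> = (meet_matrix n x f *\<^sub>v v) $ i"
      using i v(1) by (simp add: meet_matrix_def scalar_prod_def atLeast0LessThan)
    also have "\<dots> = l * (join_matrix n x f *\<^sub>v v) $ i"
      using i v by (simp add: join_matrix_def)
    also have "(join_matrix n x f *\<^sub>v v) $ i = (\<Sum>j<n. f (sup (x i) (x j)) * v $ j)"
      using i v(1) by (simp add: join_matrix_def scalar_prod_def atLeast0LessThan)
    also have "\<dots> = f (x i) * (\<Sum>j<n. g (inf (x i) (x j)) * (f (x j) * v $ j))"
      by (simp add: sup sum_distrib_left ac_simps)
    also have "\<dots> = f (x i) * ?F (Delta x g) (\<lambda>j. f (x j) * ?w j) i"
      using sum_meet_eq_congruence[OF closed mono i, of g "\<lambda>j. f (x j) * v $ j"] by simp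
    finally show ?thesis .
  qed
  then have "sq_norm_upto n (?F (Delta x f) ?w)
      = (cmod l)\<^sup>2 * sq_norm_upto n (\<lambda>i. f (x i) * ?F (Delta x g) (\<lambda>j. f (x j) * ?w j) i)"
    by (simp add: sq_norm_upto_def sum_distrib_left norm_mult power_mult_distrib)
  with p(1) pos that show thesis by simp
qed

theorem theorem1:
  fixes f g :: "'a::{locally_finite_order, bounded_lattice_bot} \<Rightarrow> complex"
    and x :: "nat \<Rightarrow> 'a" and n :: nat
  assumes "semimultiplicative f"
    and "\<And>z. f z \<noteq> 0"
    and "\<And>z. g z = 1 / f z"
    and "meet_closed (x ` {..<n})"
    and "\<And>i j. i < n \<Longrightarrow> j < n \<Longrightarrow> x i \<le> x j \<Longrightarrow> i \<le> j"
    and "\<And>i. i < n \<Longrightarrow> Delta x g i \<noteq> 0"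
  shows
    "(\<forall>l. is_gen_eigenvalue n (meet_matrix n x f) (join_matrix n x f) l \<longrightarrow>
        cmod l \<le>
          (MAX i\<in>{..<n}. cmod (Delta x f i)) * inverse (MIN i\<in>{..<n}. cmod (Delta x g i))
            * C_max n * inverse (c_min n)
          / (MIN i\<in>{..<n}. (cmod (f (x i)))\<^sup>2)) \<and>
     ((\<forall>i<n. Delta x f i \<noteq> 0) \<longrightarrow>
      (\<forall>l. is_gen_eigenvalue n (meet_matrix n x f) (join_matrix n x f) l \<longrightarrow>
        cmod l \<ge>
          (MIN i\<in>{..<n}. cmod (Delta x f i)) * inverse (MAX i\<in>{..<n}. cmod (Delta x g i))
            * inverse (C_max n) * c_min n
          / (MAX i\<in>{..<n}. (cmod (f (x i)))\<^sup>2)))"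
proof (intro conjI impI allI)
  fix l assume l: "is_gen_eigenvalue n (meet_matrix n x f) (join_matrix n x f) l"
  let ?X = "incidence_matrix n x"
  let ?F = "congruence n ?X"
  obtain w where n: "n > 0" and w: "sq_norm_upto n w > 0"
    and eq: "sq_norm_upto n (?F (Delta x f) w) = (cmod l)\<^sup>2 *
      sq_norm_upto n (\<lambda>i. f (x i) * ?F (Delta x g) (\<lambda>j. f (x j) * w j) i)"
    using gen_eigenvalue_sq_norm[OF assms(1-5) l] by blast
  have X: "?X \<in> K n" using assms(5) by (rule incidence_matrix_in_K)
  note c = c_min_pos[OF n] and C = C_max_pos[OF n]
  have Min_pos: "(MIN i\<in>{..<n}. h i) > 0" if "\<And>i. i < n \<Longrightarrow> h i > 0" for h :: "nat \<Rightarrow> real"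
    using n that by (subst Min_gr_iff) auto
  let ?mf = "MIN i\<in>{..<n}. cmod (Delta x f i)" and ?Mf = "MAX i\<in>{..<n}. cmod (Delta x f i)"
  let ?mg = "MIN i\<in>{..<n}. cmod (Delta x g i)" and ?Mg = "MAX i\<in>{..<n}. cmod (Delta x g i)"
  let ?r = "MIN i\<in>{..<n}. (cmod (f (x i)))\<^sup>2" and ?R = "MAX i\<in>{..<n}. (cmod (f (x i)))\<^sup>2"
  have mg: "?mg > 0" and r: "?r > 0" using assms(2,6) by (auto intro!: Min_pos)
  have le: "(MIN i\<in>{..<n}. h i) \<le> h i" "h i \<le> (MAX i\<in>{..<n}. h i)" if "i < n"
    for h :: "nat \<Rightarrow> real" and i
    using that by (auto intro: Min_le Max_ge)
  have "?mg \<le> ?Mg" "?r \<le> ?R" using n by (auto intro: order_trans[OF le])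
  with mg r have Mg: "?Mg > 0" and R: "?R > 0" by linarith+
  have "?Mf \<ge> cmod (Delta x f 0)" by (rule le(2)[OF n])
  then have Mf: "?Mf \<ge> 0" using norm_ge_zero order_trans by blast
  let ?N = "sq_norm_upto n w"
  let ?G = "sq_norm_upto n (\<lambda>i. f (x i) * ?F (Delta x g) (\<lambda>j. f (x j) * w j) i)"
  \<comment> \<open>The scaling by \<open>f\<close> occurs outside and inside the congruence, so
    \<open>?r\<close> enters twice; after the square root one factor, the least squared modulus of
    \<open>f\<close>, remains.\<close>
  have G_ge: "?r * ((c_min n * ?mg)\<^sup>2 * (?r * ?N)) \<le> ?G"
  proof -
    have "?r * ((c_min n * ?mg)\<^sup>2 * (?r * ?N))
        \<le> ?r * ((c_min n * ?mg)\<^sup>2 * sq_norm_upto n (\<lambda>j. f (x j) * w j))"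
      using r by (intro mult_left_mono sq_norm_upto_scale_ge le) auto
    also have "\<dots> \<le> ?r * sq_norm_upto n (?F (Delta x g) (\<lambda>j. f (x j) * w j))"
      using r mg by (intro mult_left_mono sq_norm_congruence_ge[OF X n] le) auto
    also have "\<dots> \<le> ?G" by (intro sq_norm_upto_scale_ge le)
    finally show ?thesis .
  qed
  have G_le: "?G \<le> ?R * ((C_max n * ?Mg)\<^sup>2 * (?R * ?N))"
  proof -
    have "?G \<le> ?R * sq_norm_upto n (?F (Delta x g) (\<lambda>j. f (x j) * w j))"
      by (intro sq_norm_upto_scale_le le)
    also have "\<dots> \<le> ?R * ((C_max n * ?Mg)\<^sup>2 * sq_norm_upto n (\<lambda>j. f (x j) * w j))"
      using R by (intro mult_left_mono sq_norm_congruence_le[OF X n] le) auto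
    also have "\<dots> \<le> ?R * ((C_max n * ?Mg)\<^sup>2 * (?R * ?N))"
      using R by (intro mult_left_mono sq_norm_upto_scale_le le) auto
    finally show ?thesis .
  qed
  {
    \<comment> \<open>Upper bound: the join side is estimated from below and the meet side from
      above. Cancelling the positive \<open>?N\<close> and taking square roots leaves the
      claim.\<close>
    have "(cmod l)\<^sup>2 * (?r * ((c_min n * ?mg)\<^sup>2 * (?r * ?N))) \<le> (cmod l)\<^sup>2 * ?G"
      using G_ge by (intro mult_left_mono) auto
    also have "\<dots> \<le> (C_max n * ?Mf)\<^sup>2 * ?N"
      unfolding eq[symmetric] by (intro sq_norm_congruence_le[OF X n] le)
    finally have "(cmod l * ?r * c_min n * ?mg)\<^sup>2 * ?N \<le> (C_max n * ?Mf)\<^sup>2 * ?N"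
      by (simp add: power2_eq_square ac_simps)
    then have "(cmod l * ?r * c_min n * ?mg)\<^sup>2 \<le> (C_max n * ?Mf)\<^sup>2"
      using w by (rule mult_right_le_imp_le)
    then have "cmod l * ?r * c_min n * ?mg \<le> C_max n * ?Mf"
      by (rule power2_le_imp_le) (use C Mf in simp)
    then show "cmod l \<le> ?Mf * inverse ?mg * C_max n * inverse (c_min n) / ?r"
      using r c mg by (simp add: field_simps)
  }
  {
    assume "\<forall>i<n. Delta x f i \<noteq> 0"
    then have mf: "?mf \<ge> 0" by (intro less_imp_le Min_pos) auto
    \<comment> \<open>Lower bound: the same comparison with the two estimates exchanged.\<close>
    have "(c_min n * ?mf)\<^sup>2 * ?N \<le> (cmod l)\<^sup>2 * ?G"
      unfolding eq[symmetric] using mf by (intro sq_norm_congruence_ge[OF X n] le)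
    also have "\<dots> \<le> (cmod l)\<^sup>2 * (?R * ((C_max n * ?Mg)\<^sup>2 * (?R * ?N)))"
      using G_le by (intro mult_left_mono) auto
    finally have "(c_min n * ?mf)\<^sup>2 * ?N \<le> (cmod l * ?R * C_max n * ?Mg)\<^sup>2 * ?N"
      by (simp add: power2_eq_square ac_simps)
    then have "(c_min n * ?mf)\<^sup>2 \<le> (cmod l * ?R * C_max n * ?Mg)\<^sup>2"
      using w by (rule mult_right_le_imp_le)
    then have "c_min n * ?mf \<le> cmod l * ?R * C_max n * ?Mg"
      by (rule power2_le_imp_le) (use R C Mg in simp)
    then show "cmod l \<ge> ?mf * inverse ?Mg * inverse (C_max n) * c_min n / ?R"
      using R C Mg by (simp add: field_simps)
  }
qed

end
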